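(* Assume that $(A,B)$ is stabilizable, $(C,A)$ is detectable, and $\operatorname{Ker} C\subseteq \big(\bigcap_{i=1}^r \operatorname{Ker} A_0^i\big)\cap \operatorname{Ker} L^{\top}$, where $C^{\top}C=Q-LR^{-1}L^{\top}$ is a full rank decomposition. Let $X_0\ge0$ and let $\{X_k\}_{k=0}^\infty$ be the sequence in which, for each $k\ge 0$, $X_{k+1}$ is the (unique) positive semidefinite stabilizing solution $X$ of $$A_c(X_k)^{\top}X+XA_c(X_k)-XG_c(X_k)X+H_c(X_k)=0.$$ Suppose that $\{X_k\}$ is monotone (nondecreasing or nonincreasing in the Loewner order) and $\lim_{k\to\infty}X_k=\widehat X\ge0$. Suppose the linear operator $\mathcal L_{\widehat X}$ is invertible and $\rho(\mathcal L_{\widehat X}^{-1}\Psi_{\widehat X})<1$, where $\rho$ denotes the spectral radius. Then $\{X_k\}$ converges to $\widehat X$ R-linearly: for any matrix norm $\|\cdot\|$, $$\limsup_{k\to\infty}\sqrt[k]{\|X_k-\widehat X\|}\le\widehat\gamma<1$$ for some $0<\widehat\gamma<1$.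
   Context: Data: $A,A_0^i\in\mathbb R^{n\times n}$, $B,B_0^i\in\mathbb R^{n\times m}$ ($i=1,\dots,r$), $Q=Q^{\top}\in\mathbb R^{n\times n}$, $L\in\mathbb R^{n\times m}$, $R=R^{\top}\in\mathbb R^{m\times m}$ with $R>0$ and $Q-LR^{-1}L^{\top}\ge 0$. For symmetric (Hermitian) matrices, $X\ge Y$ (resp. $X>Y$) means $X-Y$ is positive semidefinite (resp. positive definite). For Hermitian $X\in\mathbb C^{n\times n}$: $\Pi_{11}(X)=\sum_{i=1}^r A_0^{i\top}XA_0^i$, $\Pi_{12}(X)=\sum_{i=1}^r A_0^{i\top}XB_0^i$, $\Pi_{21}(X)=\sum_{i=1}^r B_0^{i\top}XA_0^i$, $\Pi_{22}(X)=\sum_{i=1}^r B_0^{i\top}XB_0^i$, and $\Pi(X)=\begin{bmatrix}\Pi_{11}(X)&\Pi_{12}(X)\\ \Pi_{21}(X)&\Pi_{22}(X)\end{bmatrix}$. For real symmetric $X\ge0$: $L_c(X)=L+\Pi_{12}(X)$, $R_c(X)=R+\Pi_{22}(X)>0$, $Q_c(X)=Q+\Pi_{11}(X)$, $A_c(X)=A-BR_c(X)^{-1}L_c(X)^{\top}$, $G_c(X)=BR_c(X)^{-1}B^{\top}$, $H_c(X)=Q_c(X)-L_c(X)R_c(X)^{-1}L_c(X)^{\top}$. Write $\widehat A=A_c(\widehat X)$, $\widehat G=G_c(\widehat X)$, $\widehat L=L_c(\widehat X)$, $\widehat R=R_c(\widehat X)$. The real-linear operators $\mathcal L_{\widehat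 X},\Psi_{\widehat X}$ on the space $\mathcal H^n$ of $n\times n$ Hermitian matrices are $$\mathcal L_{\widehat X}(Z)=(\widehat A^{\top}-\widehat X\widehat G)Z+Z(\widehat A-\widehat G\widehat X),$$ $$\Psi_{\widehat X}(Z)=\big(\widehat L\widehat R^{-1}\Pi_{22}(Z)\widehat R^{-1}B^{\top}-\Pi_{12}(Z)\widehat R^{-1}B^{\top}\big)\widehat X+\widehat X\big(B\widehat R^{-1}\Pi_{22}(Z)\widehat R^{-1}\widehat L^{\top}-B\widehat R^{-1}\Pi_{21}(Z)\big)+\widehat XB\widehat R^{-1}\Pi_{22}(Z)\widehat R^{-1}B^{\top}\widehat X+\begin{bmatrix}I&-\widehat L\widehat R^{-1}\end{bmatrix}\Pi(Z)\begin{bmatrix}I\\-\widehat R^{-1}\widehat L^{\top}\end{bmatrix}.$$ A square matrix is stable if all its eigenvalues lie in the open left half-plane. $(A,B)$ is stabilizable if $y^{*}A=\lambda y^{*}$, $\operatorname{Re}\lambda\ge0$, $y^{*}B=0$ imply $y=0$; $(C,A)$ is detectable if $Ax=\lambda x$, $\operatorname{Re}\lambda\ge 0$, $Cx=0$ imply $x=0$. A solution $X$ of the Riccati equation with coefficients $A_c(X_k),G_c(X_k),H_c(X_k)$ is stabilizing if $A_c(X_k)-G_c(X_k)X$ is stable. *)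

theory Defs
  imports "HOL-Analysis.Analysis"
begin

section \<open>Matrices\<close>

abbreviation cmat :: "real^'n^'m \<Rightarrow> complex^'n^'m" where
  "cmat \<equiv> map_matrix complex_of_real"

definition hermitian :: "complex^'n^'n \<Rightarrow> bool" where
  "hermitian Z \<longleftrightarrow> transpose (map_matrix cnj Z) = Z"

definition psd :: "real^'n^'n \<Rightarrow> bool" where
  "psd X \<longleftrightarrow> transpose X = X \<and> (\<forall>x. 0 \<le> x \<bullet> (X *v x))"

definition pd :: "real^'n^'n \<Rightarrow> bool" where
  "pd X \<longleftrightarrow> transpose X = X \<and> (\<forall>x. x \<noteq> 0 \<longrightarrow> 0 < x \<bullet> (X *v x))"

definition loewner_le :: "real^'n^'n \<Rightarrow> real^'n^'n \<Rightarrow> bool" where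
  "loewner_le X Y \<longleftrightarrow> psd (Y - X)"

definition ker :: "real^'n^'m \<Rightarrow> (real^'n) set" where
  "ker M = {x. M *v x = 0}"

definition stable :: "real^'n^'n \<Rightarrow> bool" where
  "stable A \<longleftrightarrow> (\<forall>\<mu> v. v \<noteq> 0 \<and> cmat A *v v = \<mu> *s v \<longrightarrow> Re \<mu> < 0)"

definition cnj_vec :: "complex^'n \<Rightarrow> complex^'n" where
  "cnj_vec y = (\<chi> i. cnj (y $ i))"

definition stabilizable :: "real^'n^'n \<Rightarrow> real^'m^'n \<Rightarrow> bool" where
  "stabilizable A B \<longleftrightarrow>
     (\<forall>\<mu> y. cnj_vec y v* cmat A = \<mu> *s cnj_vec y \<and> 0 \<le> Re \<mu> \<and> cnj_vec y v* cmat B = 0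
        \<longrightarrow> y = 0)"

definition hcat :: "'a^'c^'r \<Rightarrow> 'a^'d^'r \<Rightarrow> 'a^('c + 'd)^'r" where
  "hcat X Y = (\<chi> i j. case j of Inl c \<Rightarrow> X $ i $ c | Inr d \<Rightarrow> Y $ i $ d)"

definition vcat :: "'a^'c^'r \<Rightarrow> 'a^'c^'s \<Rightarrow> 'a^'c^('r + 's)" where
  "vcat X Y = (\<chi> i. case i of Inl r \<Rightarrow> X $ r | Inr s \<Rightarrow> Y $ s)"

definition is_matrix_norm :: "(real^'n^'m \<Rightarrow> real) \<Rightarrow> bool" where
  "is_matrix_norm N \<longleftrightarrow>
     (\<forall>X. 0 \<le> N X) \<and> (\<forall>X. N X = 0 \<longleftrightarrow> X = 0) \<and>
     (\<forall>c X. N (c *\<^sub>R X) = \<bar>c\<bar> * N X) \<and> (\<forall>X Y. N (X + Y) \<le> N X + N Y)"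

section \<open>The factor C\<close>

text \<open>
  The matrix C has as many rows as the rank of \<^term>\<open>Q - L ** matrix_inv R ** transpose L\<close>,
  possibly none. Index types are nonempty, so C is given by its number p of rows and its rows
  \<^term>\<open>C i\<close> for \<^term>\<open>i < p\<close>.
\<close>

definition rows_ker :: "nat \<Rightarrow> (nat \<Rightarrow> real^'n) \<Rightarrow> (real^'n) set" where
  "rows_ker p C = {x. \<forall>i<p. C i \<bullet> x = 0}"

definition rows_gram :: "nat \<Rightarrow> (nat \<Rightarrow> real^'n) \<Rightarrow> real^'n^'n" where
  "rows_gram p C = (\<chi> j k. \<Sum>i<p. C i $ j * C i $ k)"

definition full_rank_decomposition :: "nat \<Rightarrow> (nat \<Rightarrow> real^'n) \<Rightarrow> real^'n^'n \<Rightarrow> bool" where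
  "full_rank_decomposition p C M \<longleftrightarrow> rows_gram p C = M \<and> dim (C ` {..<p}) = p"

definition detectable :: "nat \<Rightarrow> (nat \<Rightarrow> real^'n) \<Rightarrow> real^'n^'n \<Rightarrow> bool" where
  "detectable p C A \<longleftrightarrow>
     (\<forall>\<mu> x. cmat A *v x = \<mu> *s x \<and> 0 \<le> Re \<mu> \<and>
        (\<forall>i<p. (\<Sum>j\<in>UNIV. complex_of_real (C i $ j) * x $ j) = 0) \<longrightarrow> x = 0)"

section \<open>Coefficients of the Riccati equation\<close>

text \<open>
  For real coefficients \<^term>\<open>A0\<close>, \<^term>\<open>B0\<close> these are used at real X, and for their
  complexifications at Hermitian X. In both cases the plain transpose is the adjoint of the
  coefficient.
\<close>

definition Pi11 :: "nat \<Rightarrow> (nat \<Rightarrow> 'a::comm_ring_1^'n^'n) \<Rightarrow> 'a^'n^'n \<Rightarrow> 'a^'n^'n" where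
  "Pi11 r A0 X = (\<Sum>i=1..r. transpose (A0 i) ** X ** A0 i)"

definition Pi12 :: "nat \<Rightarrow> (nat \<Rightarrow> 'a::comm_ring_1^'n^'n) \<Rightarrow> (nat \<Rightarrow> 'a^'m^'n)
    \<Rightarrow> 'a^'n^'n \<Rightarrow> 'a^'m^'n" where
  "Pi12 r A0 B0 X = (\<Sum>i=1..r. transpose (A0 i) ** X ** B0 i)"

definition Pi21 :: "nat \<Rightarrow> (nat \<Rightarrow> 'a::comm_ring_1^'n^'n) \<Rightarrow> (nat \<Rightarrow> 'a^'m^'n)
    \<Rightarrow> 'a^'n^'n \<Rightarrow> 'a^'n^'m" where
  "Pi21 r A0 B0 X = (\<Sum>i=1..r. transpose (B0 i) ** X ** A0 i)"

definition Pi22 :: "nat \<Rightarrow> (nat \<Rightarrow> 'a::comm_ring_1^'m^'n) \<Rightarrow> 'a^'n^'n \<Rightarrow> 'a^'m^'m" where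
  "Pi22 r B0 X = (\<Sum>i=1..r. transpose (B0 i) ** X ** B0 i)"

definition Pi_op :: "nat \<Rightarrow> (nat \<Rightarrow> 'a::comm_ring_1^'n^'n) \<Rightarrow> (nat \<Rightarrow> 'a^'m^'n)
    \<Rightarrow> 'a^'n^'n \<Rightarrow> 'a^('n + 'm)^('n + 'm)" where
  "Pi_op r A0 B0 X = vcat (hcat (Pi11 r A0 X) (Pi12 r A0 B0 X))
                          (hcat (Pi21 r A0 B0 X) (Pi22 r B0 X))"

definition Lc :: "nat \<Rightarrow> (nat \<Rightarrow> real^'n^'n) \<Rightarrow> (nat \<Rightarrow> real^'m^'n) \<Rightarrow> real^'m^'n
    \<Rightarrow> real^'n^'n \<Rightarrow> real^'m^'n" where
  "Lc r A0 B0 L X = L + Pi12 r A0 B0 X"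

definition Rc :: "nat \<Rightarrow> (nat \<Rightarrow> real^'m^'n) \<Rightarrow> real^'m^'m \<Rightarrow> real^'n^'n \<Rightarrow> real^'m^'m" where
  "Rc r B0 R X = R + Pi22 r B0 X"

definition Qc :: "nat \<Rightarrow> (nat \<Rightarrow> real^'n^'n) \<Rightarrow> real^'n^'n \<Rightarrow> real^'n^'n \<Rightarrow> real^'n^'n" where
  "Qc r A0 Q X = Q + Pi11 r A0 X"

definition Ac :: "nat \<Rightarrow> (nat \<Rightarrow> real^'n^'n) \<Rightarrow> (nat \<Rightarrow> real^'m^'n)
    \<Rightarrow> real^'n^'n \<Rightarrow> real^'m^'n \<Rightarrow> real^'m^'n \<Rightarrow> real^'m^'m \<Rightarrow> real^'n^'n \<Rightarrow> real^'n^'n" where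
  "Ac r A0 B0 A B L R X =
     A - B ** matrix_inv (Rc r B0 R X) ** transpose (Lc r A0 B0 L X)"

definition Gc :: "nat \<Rightarrow> (nat \<Rightarrow> real^'m^'n) \<Rightarrow> real^'m^'n \<Rightarrow> real^'m^'m
    \<Rightarrow> real^'n^'n \<Rightarrow> real^'n^'n" where
  "Gc r B0 B R X = B ** matrix_inv (Rc r B0 R X) ** transpose B"

definition Hc :: "nat \<Rightarrow> (nat \<Rightarrow> real^'n^'n) \<Rightarrow> (nat \<Rightarrow> real^'m^'n)
    \<Rightarrow> real^'n^'n \<Rightarrow> real^'m^'n \<Rightarrow> real^'m^'m \<Rightarrow> real^'n^'n \<Rightarrow> real^'n^'n" where
  "Hc r A0 B0 Q L R X =
     Qc r A0 Q X - Lc r A0 B0 L X ** matrix_inv (Rc r B0 R X) ** transpose (Lc r A0 B0 L X)"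

definition psd_stabilizing_solution ::
    "real^'n^'n \<Rightarrow> real^'n^'n \<Rightarrow> real^'n^'n \<Rightarrow> real^'n^'n \<Rightarrow> bool" where
  "psd_stabilizing_solution A G H X \<longleftrightarrow>
     psd X \<and> transpose A ** X + X ** A - X ** G ** X + H = 0 \<and> stable (A - G ** X)"

section \<open>Operators on Hermitian matrices\<close>

definition Lyap_op :: "nat \<Rightarrow> (nat \<Rightarrow> real^'n^'n) \<Rightarrow> (nat \<Rightarrow> real^'m^'n)
    \<Rightarrow> real^'n^'n \<Rightarrow> real^'m^'n \<Rightarrow> real^'m^'n \<Rightarrow> real^'m^'m \<Rightarrow> real^'n^'n
    \<Rightarrow> complex^'n^'n \<Rightarrow> complex^'n^'n" where
  "Lyap_op r A0 B0 A B L R Xh Z =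
     (let Ah = Ac r A0 B0 A B L R Xh; Gh = Gc r B0 B R Xh
      in cmat (transpose Ah - Xh ** Gh) ** Z + Z ** cmat (Ah - Gh ** Xh))"

definition Psi_op :: "nat \<Rightarrow> (nat \<Rightarrow> real^'n^'n) \<Rightarrow> (nat \<Rightarrow> real^'m^'n)
    \<Rightarrow> real^'m^'n \<Rightarrow> real^'m^'n \<Rightarrow> real^'m^'m \<Rightarrow> real^'n^'n
    \<Rightarrow> complex^'n^'n \<Rightarrow> complex^'n^'n" where
  "Psi_op r A0 B0 B L R Xh Z =
     (let cA0 = (\<lambda>i. cmat (A0 i)); cB0 = (\<lambda>i. cmat (B0 i));
          Xc = cmat Xh; Bh = cmat B; Bt = cmat (transpose B);
          Lh = cmat (Lc r A0 B0 L Xh); Lt = cmat (transpose (Lc r A0 B0 L Xh));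
          Ri = cmat (matrix_inv (Rc r B0 R Xh));
          P12 = Pi12 r cA0 cB0 Z; P21 = Pi21 r cA0 cB0 Z; P22 = Pi22 r cB0 Z
      in (Lh ** Ri ** P22 ** Ri ** Bt - P12 ** Ri ** Bt) ** Xc
         + Xc ** (Bh ** Ri ** P22 ** Ri ** Lt - Bh ** Ri ** P21)
         + Xc ** Bh ** Ri ** P22 ** Ri ** Bt ** Xc
         + hcat (mat 1) (- (Lh ** Ri)) ** Pi_op r cA0 cB0 Z ** vcat (mat 1) (- (Ri ** Lt)))"

text \<open>
  The Hermitian matrices form a real vector space only, so the spectrum of a real-linear operator
  T on it is that of the complexification: \<^term>\<open>\<mu>\<close> is an eigenvalue iff
  T (U + i V) = \<^term>\<open>\<mu>\<close> (U + i V) for some formal U + i V that is nonzero, with U and V in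
  the space, which is written below in real and imaginary parts. On a nonzero
  finite-dimensional space the spectrum is finite and nonempty, so the supremum is a maximum.
\<close>

definition op_eigenvalue :: "'a::real_vector set \<Rightarrow> ('a \<Rightarrow> 'a) \<Rightarrow> complex \<Rightarrow> bool" where
  "op_eigenvalue S T \<mu> \<longleftrightarrow>
     (\<exists>U\<in>S. \<exists>V\<in>S. (U \<noteq> 0 \<or> V \<noteq> 0) \<and>
        T U = Re \<mu> *\<^sub>R U - Im \<mu> *\<^sub>R V \<and> T V = Im \<mu> *\<^sub>R U + Re \<mu> *\<^sub>R V)"

definition op_spectral_radius :: "'a::real_vector set \<Rightarrow> ('a \<Rightarrow> 'a) \<Rightarrow> real" where
  "op_spectral_radius S T = Sup {cmod \<mu> | \<mu>. op_eigenvalue S T \<mu>}"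

end

theory Submission
  imports Defs "HOL-Computational_Algebra.Fundamental_Theorem_Algebra"
begin

text \<open>
  Write the Riccati equation for the step from Y to W as
  Q + \<Pi>11(Y) + A'W + WA - S R(Y)^-1 S' = 0 with S = L(Y) + WB, and complete the square at the
  limit feedback K. What remains is affine in (Y, W), with linear part
  \<L>(W - Xhat) + \<Psi>(Y - Xhat), up to a remainder D R(Y)^-1 D' in which D is linear in
  (Y - Xhat, W - Xhat). As R(Y) \<ge> R > 0 keeps R(Y)^-1 bounded, the errors satisfy
  E(k+1) = - \<L>^-1 \<Psi> E(k) + a quadratic term, and in a norm adapted to the spectral radius
  the operator \<L>^-1 \<Psi> is a contraction, so the errors eventually decrease geometrically.
\<close>

section \<open>Operators with small spectral radius\<close>

text \<open>No hypothesis says that \<open>Xhat\<close> solves the limit equation. Completing the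
  square therefore leaves a constant, which vanishes on letting k tend to infinity, the uniform
  bound on the inverses controlling the remainder. The feedback at \<open>Xhat\<close> is the choice
  that makes the squared factor zero at the limit, hence of first order in the errors. Three
  obstacles shape the rest. Hermitian matrices are a subspace and not a type, so \<L>^-1 \<Psi> is
  extended to all complex matrices with values in that subspace; the only eigenvalue this can add is
  0. The operator is only real-linear, so its complex eigenvalues live on pairs of matrices, and the
  i of the pairs is unrelated to the i in the entries. Finally the recurrence is implicit: the
  quadratic term contains the new error as well, and can be absorbed only once the errors are small,
  so the assumed convergence is what starts the estimate.\<close>

lemma affine_recurrence_bound:
  fixes a :: "nat \<Rightarrow> real"
  assumes step: "\<And>k. a (Suc k) \<le> l * a k + D * q ^ k"
    and "0 \<le> l" "l < q" "0 \<le> D"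
  shows "\<exists>C. \<forall>k. a k \<le> C * q ^ k"
proof -
  \<comment> \<open>\<open>D / (q - l)\<close> is the least C with
    \<open>l * C + D \<le> C * q\<close>, the inequality that carries the induction;
    \<open>a 0\<close> covers its start.\<close>
  define C where "C = max (a 0) (D / (q - l))"
  have "D / (q - l) \<le> C" by (simp add: C_def)
  then have CD: "l * C + D \<le> C * q"
    using assms by (simp add: divide_simps algebra_simps split: if_splits)
  have "a k \<le> C * q ^ k" for k
  proof (induction k)
    case 0
    then show ?case by (simp add: C_def)
  next
    case (Suc k)
    have "a (Suc k) \<le> l * (C * q ^ k) + D * q ^ k"
      using step[of k] mult_left_mono[OF Suc assms(2)] by linarith
    also have "\<dots> = (l * C + D) * q ^ k" by (simp add: algebra_simps)
    also have "\<dots> \<le> (C * q) * q ^ k"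
      using CD assms by (intro mult_right_mono) auto
    finally show ?case by (simp add: algebra_simps)
  qed
  then show ?thesis by blast
qed

section \<open>Orbits annihilated by a polynomial in the operator\<close>

definition poly_op :: "(complex \<Rightarrow> 'w \<Rightarrow> 'w) \<Rightarrow> ('w \<Rightarrow> 'w) \<Rightarrow> complex poly \<Rightarrow> 'w \<Rightarrow> 'w::comm_monoid_add"
  where "poly_op sc T p w = (\<Sum>i\<le>degree p. sc (coeff p i) ((T ^^ i) w))"

text \<open>The complex scaling \<open>sc\<close> is a parameter because the complexification is
  realised on pairs, whose type carries a real scaling only. Finite dimension enters later, through
  the polynomial that annihilates an orbit.\<close>

locale complex_operator = vector_space sc
  for sc :: "complex \<Rightarrow> 'w::real_normed_vector \<Rightarrow> 'w" +
  fixes T :: "'w \<Rightarrow> 'w"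
  assumes norm_scale: "norm (sc c w) = cmod c * norm w"
    and T_add: "T (v + w) = T v + T w"
    and T_scale: "T (sc c w) = sc c (T w)"
begin

lemma T_diff: "T (v - w) = T v - T w"
  by (metis T_add add_diff_cancel diff_add_cancel)

lemma T_zero: "T 0 = 0"
  using T_diff[of 0 0] by simp

lemma T_sum: "T (sum f I) = (\<Sum>i\<in>I. T (f i))"
  by (induction I rule: infinite_finite_induct) (simp_all add: T_add T_zero)

lemma funpow_diff: "(T ^^ k) (v - w) = (T ^^ k) v - (T ^^ k) w"
  by (induction k) (simp_all add: T_diff)

lemma funpow_scale: "(T ^^ k) (sc c w) = sc c ((T ^^ k) w)"
  by (induction k) (simp_all add: T_scale)

lemma poly_op_eq_sum:
  "degree p \<le> n \<Longrightarrow> poly_op sc T p w = (\<Sum>i\<le>n. sc (coeff p i) ((T ^^ i) w))"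
  unfolding poly_op_def
  by (rule sum.mono_neutral_left) (auto simp: coeff_eq_0)

lemma poly_op_diff: "poly_op sc T p (v - w) = poly_op sc T p v - poly_op sc T p w"
  by (simp add: poly_op_def funpow_diff scale_right_diff_distrib sum_subtractf)

lemma poly_op_scale: "poly_op sc T p (sc c w) = sc c (poly_op sc T p w)"
  by (simp add: poly_op_def funpow_scale scale_left_commute scale_sum_right mult.commute)

lemma poly_op_T: "poly_op sc T p (T w) = T (poly_op sc T p w)"
  by (simp add: poly_op_def T_sum T_scale funpow_swap1)

text \<open>Multiplication by X shifts the coefficients up by one, so every term gains one more T.
  Both sums run to \<open>Suc (degree p)\<close> so that the shifted one fits.\<close>

lemma poly_op_linear_factor:
  "poly_op sc T ([:- c, 1:] * p) w = T (poly_op sc T p w) - sc c (poly_op sc T p w)"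
proof -
  define n where "n = Suc (degree p)"
  have le: "degree ([:- c, 1:] * p) \<le> n"
    using degree_mult_le[of "[:- c, 1:]" p] by (simp add: n_def)
  have co: "coeff ([:- c, 1:] * p) i = (case i of 0 \<Rightarrow> 0 | Suc j \<Rightarrow> coeff p j) - c * coeff p i" for i
    by (cases i) (simp_all add: coeff_pCons)
  have "poly_op sc T ([:- c, 1:] * p) w
      = (\<Sum>i\<le>n. sc (case i of 0 \<Rightarrow> 0 | Suc j \<Rightarrow> coeff p j) ((T ^^ i) w))
        - (\<Sum>i\<le>n. sc (c * coeff p i) ((T ^^ i) w))"
    unfolding poly_op_eq_sum[OF le] co by (simp add: scale_left_diff_distrib sum_subtractf)
  also have "(\<Sum>i\<le>n. sc (case i of 0 \<Rightarrow> 0 | Suc j \<Rightarrow> coeff p j) ((T ^^ i) w))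
      = T (poly_op sc T p w)"
    unfolding n_def sum.atMost_Suc_shift by (simp add: poly_op_def T_sum T_scale)
  also have "(\<Sum>i\<le>n. sc (c * coeff p i) ((T ^^ i) w)) = sc c (poly_op sc T p w)"
    by (subst poly_op_eq_sum[of p n]) (simp_all add: n_def scale_sum_right scale_right_distrib)
  finally show ?thesis .
qed

text \<open>
  A root c of p is an eigenvalue, hence smaller than q, unless the factor X - c can be cancelled
  from p; in the first case the orbit of T w - c w decays by induction, and that of w solves an
  affine recurrence.
\<close>
lemma annihilated_orbit_bound:
  assumes q: "0 < q"
    and eig: "\<And>\<mu> v. T v = sc \<mu> v \<Longrightarrow> q \<le> cmod \<mu> \<Longrightarrow> v = 0"
    and "p \<noteq> 0" "poly_op sc T p w = 0"
  shows "\<exists>D. \<forall>k. norm ((T ^^ k) w) \<le> D * q ^ k"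
  using assms(3,4)
proof (induction "degree p" arbitrary: p w)
  case 0
  then have "coeff p 0 \<noteq> 0" by (metis leading_coeff_0_iff)
  then have "w = 0" using 0 by (simp add: poly_op_def)
  moreover have "(T ^^ k) 0 = 0" for k by (induction k) (simp_all add: T_zero)
  ultimately show ?case by (auto intro!: exI[of _ 0])
next
  case (Suc n)
  then have "\<not> constant (poly p)" by (simp add: constant_degree)
  then obtain c where "poly p c = 0" using fundamental_theorem_of_algebra by blast
  then obtain s where ps: "p = [:- c, 1:] * s" by (metis dvdE poly_eq_0_iff_dvd)
  then have s0: "s \<noteq> 0" using Suc by auto
  have ds: "degree s = n"
    using Suc.hyps(2) s0 unfolding ps by (subst (asm) degree_mult_eq) auto
  define z where "z = poly_op sc T s w"
  have Tz: "T z = sc c z"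
    using Suc.prems(2) unfolding ps poly_op_linear_factor z_def by simp
  show ?case
  proof (cases "q \<le> cmod c")
    case True
    then have "z = 0" using eig Tz by blast
    then show ?thesis using Suc.hyps(1)[of s w] ds s0 by (simp add: z_def)
  next
    case False
    define y where "y = T w - sc c w"
    \<comment> \<open>s(T) commutes with T - c, so s(T) y = (T - c) z = 0.\<close>
    have "poly_op sc T s y = 0"
      using Tz by (simp add: y_def poly_op_diff poly_op_T poly_op_scale z_def)
    then obtain D where D: "norm ((T ^^ k) y) \<le> D * q ^ k" for k
      using Suc.hyps(1)[of s y] ds s0 by blast
    have D0: "0 \<le> D" using D[of 0] order_trans[OF norm_ge_zero] by simp
    show ?thesis
    proof (rule affine_recurrence_bound[of _ "cmod c" D])
      fix k
      have "(T ^^ Suc k) w = sc c ((T ^^ k) w) + (T ^^ k) y"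
        by (simp add: y_def funpow_diff funpow_scale funpow_swap1)
      then have "norm ((T ^^ Suc k) w) \<le> cmod c * norm ((T ^^ k) w) + norm ((T ^^ k) y)"
        by (metis norm_scale norm_triangle_ineq)
      then show "norm ((T ^^ Suc k) w) \<le> cmod c * norm ((T ^^ k) w) + D * q ^ k"
        using D[of k] by linarith
    qed (use False D0 in auto)
  qed
qed

end

section \<open>Complexification by pairs\<close>

text \<open>The pair (u, v) stands for u + i v in the complexification.\<close>
definition cscale :: "complex \<Rightarrow> 'a \<times> 'a \<Rightarrow> 'a \<times> 'a::real_vector" where
  "cscale c w = (Re c *\<^sub>R fst w - Im c *\<^sub>R snd w, Im c *\<^sub>R fst w + Re c *\<^sub>R snd w)"

text \<open>The cross terms in u and v cancel between the two squares; this is where an inner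
  product space is required.\<close>

lemma norm_cscale: "norm (cscale c w) = cmod c * norm (w :: 'a \<times> 'a::real_inner)"
proof -
  have "(norm (Re c *\<^sub>R u - Im c *\<^sub>R v))\<^sup>2 + (norm (Im c *\<^sub>R u + Re c *\<^sub>R v))\<^sup>2
      = ((Re c)\<^sup>2 + (Im c)\<^sup>2) * ((norm u)\<^sup>2 + (norm v)\<^sup>2)" for u v :: 'a
    unfolding power2_norm_eq_inner by (simp add: inner_simps algebra_simps power2_eq_square inner_commute)
  then show ?thesis
    by (cases w) (simp add: cscale_def norm_Pair cmod_def real_sqrt_mult)
qed

lemma complex_operator_cscale:
  fixes T :: "'a::real_inner \<Rightarrow> 'a"
  assumes "linear T"
  shows "complex_operator cscale (map_prod T T)"
proof -
  interpret T: linear T by fact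
  show ?thesis
  proof
    show "norm (cscale c w) = cmod c * norm w" for c and w :: "'a \<times> 'a"
      by (rule norm_cscale)
  qed (auto simp: cscale_def T.add T.diff T.scale algebra_simps)
qed

lemma op_eigenvalue_iff_cscale:
  "op_eigenvalue UNIV T \<mu> \<longleftrightarrow> (\<exists>w. w \<noteq> 0 \<and> map_prod T T w = cscale \<mu> w)"
  by (auto simp: op_eigenvalue_def cscale_def zero_prod_def)

text \<open>Supplies the upper bound that the supremum in \<open>op_spectral_radius\<close>
  needs.\<close>

lemma op_eigenvalue_cmod_le:
  fixes T :: "'a::real_inner \<Rightarrow> 'a"
  assumes bound: "\<And>x. norm (T x) \<le> K * norm x" and "op_eigenvalue UNIV T \<mu>"
  shows "cmod \<mu> \<le> K"
proof -
  obtain u v where uv: "(u, v) \<noteq> 0" "(T u, T v) = cscale \<mu> (u, v)"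
    using assms(2) by (auto simp: op_eigenvalue_iff_cscale)
  \<comment> \<open>A nonzero component forces K to be nonnegative, so that K can leave the square
    root below.\<close>
  obtain x where "x \<in> {u, v}" "x \<noteq> 0" using uv(1) by (auto simp: zero_prod_def)
  moreover have "0 \<le> K * norm x" using bound[of x] order_trans[OF norm_ge_zero] by blast
  ultimately have "0 \<le> K" by (simp add: zero_le_mult_iff)
  have "cmod \<mu> * norm (u, v) = norm (T u, T v)"
    using uv(2) by (simp add: norm_cscale)
  also have "\<dots> \<le> sqrt ((K * norm u)\<^sup>2 + (K * norm v)\<^sup>2)"
    unfolding norm_Pair using bound by (intro real_sqrt_le_mono add_mono power_mono) auto
  also have "\<dots> = K * norm (u, v)"
    using \<open>0 \<le> K\<close> by (simp add: norm_Pair power_mult_distrib real_sqrt_mult flip: distrib_left)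
  finally show ?thesis using uv(1) by (simp add: zero_prod_def)
qed

text \<open>There are \<open>DIM('a) + 1\<close> iterates, one too many to be independent. As
  \<open>dependent\<close> speaks of sets, a repeated iterate is treated apart: there the relation
  is the difference of two equal terms.\<close>

lemma dependent_orbit:
  fixes T :: "'a::euclidean_space \<Rightarrow> 'a"
  shows "\<exists>c n. (\<exists>i\<le>n. c i \<noteq> 0) \<and> (\<Sum>i\<le>n. c i *\<^sub>R (T ^^ i) x) = 0"
proof -
  define n where "n = DIM('a)"
  define f where "f = (\<lambda>i. (T ^^ i) x)"
  show ?thesis
  proof (cases "inj_on f {..n}")
    case True
    then have "card (f ` {..n}) > DIM('a)" by (simp add: card_image n_def)
    then have "dependent (f ` {..n})" by (intro dependent_biggerset) auto
    then obtain u where u: "\<exists>v\<in>f ` {..n}. u v \<noteq> 0" "(\<Sum>v\<in>f ` {..n}. u v *\<^sub>R v) = 0"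
      by (auto simp: dependent_finite)
    then show ?thesis
      unfolding sum.reindex[OF True] by (intro exI[of _ "u \<circ> f"] exI[of _ n]) (auto simp: f_def)
  next
    case False
    then obtain i j where ij: "i \<le> n" "j \<le> n" "i \<noteq> j" "f i = f j" by (auto simp: inj_on_def)
    have "(\<Sum>k\<le>n. (if k = i then 1 else if k = j then -1 else 0) *\<^sub>R f k)
        = (\<Sum>k\<le>n. (if k = i then f k else 0) - (if k = j then f k else 0))"
      using ij(3) by (intro sum.cong) auto
    also have "\<dots> = 0" using ij by (simp add: sum_subtractf)
    finally show ?thesis using ij
      by (intro exI[of _ "\<lambda>k. if k = i then 1 else if k = j then -1 else 0"] exI[of _ n]) (auto simp: f_def)
  qed
qed

text \<open>A real relation between the iterates of x becomes a complex polynomial annihilating (x,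
  0), and its roots are tested against eigenvalues of the complexification. The constant D may
  depend on x.\<close>

lemma spectral_orbit_bound:
  fixes T :: "'a::euclidean_space \<Rightarrow> 'a"
  assumes "linear T" and q: "0 < q" and eig: "\<And>\<mu>. op_eigenvalue UNIV T \<mu> \<Longrightarrow> cmod \<mu> < q"
  shows "\<exists>D. \<forall>k. norm ((T ^^ k) x) \<le> D * q ^ k"
proof -
  interpret complex_operator cscale "map_prod T T" by (rule complex_operator_cscale) fact
  have pow: "(map_prod T T ^^ k) (u, v) = ((T ^^ k) u, (T ^^ k) v)" for k u v
    by (induction k) auto
  obtain c n where c: "\<exists>i\<le>n. c i \<noteq> 0" "(\<Sum>i\<le>n. c i *\<^sub>R (T ^^ i) x) = 0"
    using dependent_orbit[of T x] by blast
  define p where "p = (\<Sum>i\<le>n. monom (complex_of_real (c i)) i)"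
  have co: "coeff p i = (if i \<le> n then complex_of_real (c i) else 0)" for i
    by (simp add: p_def coeff_sum)
  have deg: "degree p \<le> n" by (rule degree_le) (simp add: co)
  have "p \<noteq> 0" using c(1) co by (metis coeff_0 of_real_eq_0_iff)
  have "(T ^^ i) 0 = 0" for i using assms(1) by (induction i) (auto simp: linear_0)
  then have "poly_op cscale (map_prod T T) p (x, 0) = (\<Sum>i\<le>n. (c i *\<^sub>R (T ^^ i) x, 0))"
    unfolding poly_op_eq_sum[OF deg] by (intro sum.cong) (simp_all add: co pow cscale_def)
  also have "\<dots> = 0" using c(2) by (simp add: sum_prod zero_prod_def)
  finally have "poly_op cscale (map_prod T T) p (x, 0) = 0" .
  then obtain D where "\<forall>k. norm ((map_prod T T ^^ k) (x, 0)) \<le> D * q ^ k"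
    using annihilated_orbit_bound[OF q _ \<open>p \<noteq> 0\<close>] eig
    unfolding op_eigenvalue_iff_cscale by (metis not_le)
  moreover have "norm ((T ^^ k) x) \<le> norm ((map_prod T T ^^ k) (x, 0))" for k
    unfolding pow by (metis fst_conv norm_fst_le)
  ultimately show ?thesis by (meson order_trans)
qed

section \<open>Adapted norms and geometric decay of perturbed iterations\<close>

lemma seminorm_bounded:
  fixes N :: "'a::euclidean_space \<Rightarrow> real"
  assumes add: "\<And>x y. N (x + y) \<le> N x + N y" and scale: "\<And>c x. N (c *\<^sub>R x) \<le> \<bar>c\<bar> * N x"
    and nonneg: "\<And>x. 0 \<le> N x"
  shows "\<exists>K>0. \<forall>x. N x \<le> K * norm x"
proof -
  have N0: "N 0 = 0" using scale[of 0 0] nonneg[of 0] by simp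
  have Nsum: "N (sum f I) \<le> (\<Sum>i\<in>I. N (f i))" for f and I :: "'a set"
  proof (induction I rule: infinite_finite_induct)
    case (insert i I)
    then show ?case using add[of "f i" "sum f I"] by simp
  qed (simp_all add: N0)
  \<comment> \<open>The summand 1 keeps the constant positive even if N vanishes on the
    basis.\<close>
  have "N x \<le> (1 + (\<Sum>b\<in>Basis. N b)) * norm x" for x
  proof -
    have "N x = N (\<Sum>b\<in>Basis. (x \<bullet> b) *\<^sub>R b)" by (simp add: euclidean_representation)
    also have "\<dots> \<le> (\<Sum>b\<in>Basis. N ((x \<bullet> b) *\<^sub>R b))" by (rule Nsum)
    also have "\<dots> \<le> (\<Sum>b\<in>Basis. norm x * N b)"
    proof (rule sum_mono)
      fix b :: 'a assume "b \<in> Basis"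
      then have "\<bar>x \<bullet> b\<bar> \<le> norm x" by (rule Basis_le_norm)
      then show "N ((x \<bullet> b) *\<^sub>R b) \<le> norm x * N b"
        using scale[of "x \<bullet> b" b] mult_right_mono[OF _ nonneg[of b]] by fastforce
    qed
    also have "\<dots> \<le> (1 + (\<Sum>b\<in>Basis. N b)) * norm x"
      by (simp add: sum_distrib_left algebra_simps)
    finally show ?thesis .
  qed
  moreover have "1 + (\<Sum>b\<in>Basis. N b) > (0::real)"
    using sum_nonneg[of Basis N] nonneg by (simp add: add_pos_nonneg)
  ultimately show ?thesis by blast
qed

text \<open>The witness is N x = sup over k of |T^k x| / q^k.\<close>
lemma adapted_norm:
  fixes T :: "'a::euclidean_space \<Rightarrow> 'a"
  assumes lin: "linear T" and q: "0 < q" and eig: "\<And>\<mu>. op_eigenvalue UNIV T \<mu> \<Longrightarrow> cmod \<mu> < q"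
  obtains N :: "'a \<Rightarrow> real" and K where
    "\<And>x y. N (x + y) \<le> N x + N y" "\<And>x. N (- x) = N x" "\<And>x. norm x \<le> N x"
    "\<And>x. N x \<le> K * norm x" "0 < K" "\<And>x. N (T x) \<le> q * N x"
proof -
  have linp: "linear (T ^^ k)" for k
    proof (induction k)
    case 0
    show ?case using linear_id by (simp add: id_def)
  next
    case (Suc k)
    show ?case using linear_compose[OF Suc lin] by (simp add: comp_def)
  qed
  define s where "s = (\<lambda>x k. norm ((T ^^ k) x) / q ^ k)"
  define N where "N = (\<lambda>x. SUP k. s x k)"
  have bdd: "bdd_above (range (s x))" for x
  proof -
    obtain D where "norm ((T ^^ k) x) \<le> D * q ^ k" for k
      using spectral_orbit_bound[OF assms] by blast
    then have "s x k \<le> D" for k using q by (simp add: s_def divide_simps)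
    then show ?thesis by (auto simp: bdd_above_def)
  qed
  have le: "s x k \<le> N x" for x k unfolding N_def by (intro cSUP_upper bdd) simp
  have least: "N x \<le> c" if "\<And>k. s x k \<le> c" for x c
    unfolding N_def using that by (intro cSUP_least) auto
  have norm_le: "norm x \<le> N x" for x using le[of x 0] by (simp add: s_def)
  have nonneg: "0 \<le> N x" for x using norm_le[of x] norm_ge_zero order_trans by blast
  have add: "N (x + y) \<le> N x + N y" for x y
  proof (rule least)
    fix k
    have "norm ((T ^^ k) (x + y)) \<le> norm ((T ^^ k) x) + norm ((T ^^ k) y)"
      by (simp add: linear_add[OF linp] norm_triangle_ineq)
    then have "s (x + y) k \<le> s x k + s y k"
      using q by (simp add: s_def divide_right_mono flip: add_divide_distrib)
    then show "s (x + y) k \<le> N x + N y" using le[of x k] le[of y k] by linarith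
  qed
  have scale: "N (c *\<^sub>R x) \<le> \<bar>c\<bar> * N x" for c x
  proof (rule least)
    fix k
    have "s (c *\<^sub>R x) k = \<bar>c\<bar> * s x k" by (simp add: s_def linear_scale[OF linp])
    then show "s (c *\<^sub>R x) k \<le> \<bar>c\<bar> * N x" using le[of x k] by (simp add: mult_left_mono)
  qed
  have neg: "N (- x) = N x" for x by (simp add: N_def s_def linear_neg[OF linp])
  have contr: "N (T x) \<le> q * N x" for x
  proof (rule least)
    fix k
    \<comment> \<open>Applying T shifts the orbit by one index, at the price of exactly one factor
      q.\<close>
    have "s (T x) k = q * s x (Suc k)" using q by (simp add: s_def funpow_swap1)
    then show "s (T x) k \<le> q * N x" using le[of x "Suc k"] q by simp
  qed
  \<comment> \<open>The orbit bounds depend on x; uniformity comes from expanding x in the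
    basis.\<close>
  obtain K where "0 < K" "\<forall>x. N x \<le> K * norm x"
    using seminorm_bounded[OF add scale nonneg] by blast
  then show ?thesis using that[OF add neg norm_le] contr by blast
qed

text \<open>Since e tends to 0, one factor of the square eventually drops below a small d. The
  remainder is then at most d times the sum of both errors, and the share of the new error moves to
  the left-hand side.\<close>

lemma perturbed_iteration_linear_convergence:
  fixes T :: "'a::euclidean_space \<Rightarrow> 'a" and e :: "nat \<Rightarrow> 'a"
  assumes lin: "linear T" and q: "0 < q" "q < 1"
    and eig: "\<And>\<mu>. op_eigenvalue UNIV T \<mu> \<Longrightarrow> cmod \<mu> < q"
    and "e \<longlonglongrightarrow> 0" and "0 \<le> c"
    and step: "\<And>k. norm (e (Suc k) + T (e k)) \<le> c * (norm (e k) + norm (e (Suc k)))\<^sup>2"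
  shows "\<exists>\<gamma> M. 0 < \<gamma> \<and> \<gamma> < 1 \<and> 0 < M \<and> (\<forall>\<^sub>F k in sequentially. norm (e k) \<le> M * \<gamma> ^ k)"
proof -
  obtain N K where add: "\<And>x y. N (x + y) \<le> N x + N y" and neg: "\<And>x. N (- x) = N x"
    and ge: "\<And>x. norm x \<le> N x" and le: "\<And>x. N x \<le> K * norm x" and K: "0 < K"
    and contr: "\<And>x. N (T x) \<le> q * N x"
    using adapted_norm[OF lin q(1) eig] by metis
  \<comment> \<open>The ratio (q + d) / (1 - d) is below 1 as soon as 2 d < 1 - q.\<close>
  define d where "d = (1 - q) / 4"
  define \<gamma> where "\<gamma> = (q + d) / (1 - d)"
  have d: "0 < d" "d < 1" using q by (auto simp: d_def)
  have \<gamma>: "0 < \<gamma>" "\<gamma> < 1" using q by (auto simp: \<gamma>_def d_def divide_simps)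
  have n0: "0 \<le> N x" for x using ge[of x] norm_ge_zero order_trans by blast
  have "(\<lambda>k. K * c * (norm (e k) + norm (e (Suc k)))) \<longlonglongrightarrow> K * c * (0 + 0)"
    using \<open>e \<longlonglongrightarrow> 0\<close> LIMSEQ_Suc[OF \<open>e \<longlonglongrightarrow> 0\<close>] by (intro tendsto_intros tendsto_norm_zero) auto
  then have "\<forall>\<^sub>F k in sequentially. K * c * (norm (e k) + norm (e (Suc k))) < d"
    using d by (intro order_tendstoD(2)) auto
  then obtain k0 where k0: "\<And>k. k0 \<le> k \<Longrightarrow> K * c * (norm (e k) + norm (e (Suc k))) \<le> d"
    unfolding eventually_sequentially by (meson less_imp_le)
  have ratio: "N (e (Suc k)) \<le> \<gamma> * N (e k)" if "k0 \<le> k" for k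
  proof -
    let ?r = "e (Suc k) + T (e k)" and ?s = "norm (e k) + norm (e (Suc k))"
    have "N ?r \<le> K * (c * ?s\<^sup>2)"
      using le[of ?r] mult_left_mono[OF step[of k], of K] K by linarith
    also have "\<dots> = (K * c * ?s) * ?s" by (simp add: power2_eq_square)
    also have "\<dots> \<le> d * ?s" using k0[OF that] by (intro mult_right_mono) auto
    also have "\<dots> \<le> d * (N (e k) + N (e (Suc k)))"
      using ge[of "e k"] ge[of "e (Suc k)"] d by (intro mult_left_mono) auto
    finally have "N ?r \<le> d * N (e k) + d * N (e (Suc k))" by (simp add: algebra_simps)
    moreover have "N (e (Suc k)) \<le> N ?r + q * N (e k)"
      using add[of ?r "- T (e k)"] neg[of "T (e k)"] contr[of "e k"] by simp
    ultimately have "(1 - d) * N (e (Suc k)) \<le> (q + d) * N (e k)" by (simp add: algebra_simps)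
    then show ?thesis using d by (simp add: \<gamma>_def divide_simps mult.commute)
  qed
  have iter: "N (e (k0 + j)) \<le> \<gamma> ^ j * N (e k0)" for j
  proof (induction j)
    case (Suc j)
    have "N (e (k0 + Suc j)) \<le> \<gamma> * N (e (k0 + j))" using ratio[of "k0 + j"] by simp
    also have "\<dots> \<le> \<gamma> * (\<gamma> ^ j * N (e k0))" using Suc \<gamma> by (intro mult_left_mono) auto
    finally show ?case by (simp add: mult.assoc)
  qed simp
  \<comment> \<open>Dividing by \<open>\<gamma> ^ k0\<close> makes up for the late start; the 1
    keeps M positive if the error at k0 is zero.\<close>
  define M where "M = (1 + N (e k0)) / \<gamma> ^ k0"
  have "0 < M" using \<gamma> n0[of "e k0"] by (simp add: M_def)
  moreover have "norm (e k) \<le> M * \<gamma> ^ k" if "k0 \<le> k" for k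
  proof -
    have "norm (e k) \<le> \<gamma> ^ (k - k0) * N (e k0)"
      using ge[of "e k"] iter[of "k - k0"] that by simp
    also have "\<dots> \<le> \<gamma> ^ (k - k0) * (1 + N (e k0))" using \<gamma> by (intro mult_left_mono) auto
    also have "\<dots> = M * \<gamma> ^ k" using \<gamma> that by (simp add: M_def power_diff)
    finally show ?thesis .
  qed
  ultimately show ?thesis using \<gamma> unfolding eventually_sequentially by blast
qed

text \<open>Changing the norm costs a constant factor, whose k-th root tends to 1. Hence one
  \<gamma> serves all norms.\<close>

lemma matrix_norm_limsup_root_le:
  fixes N :: "real^'n^'n \<Rightarrow> real"
  assumes N: "is_matrix_norm N" and "0 < \<gamma>" "0 < M"
    and bound: "\<forall>\<^sub>F k in sequentially. norm (E k) \<le> M * \<gamma> ^ k"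
  shows "limsup (\<lambda>k. ereal (root k (N (E k)))) \<le> ereal \<gamma>"
proof -
  obtain K where K: "0 < K" "\<And>Z. N Z \<le> K * norm Z"
    using seminorm_bounded[of N] N unfolding is_matrix_norm_def by (metis order_refl)
  have "\<forall>\<^sub>F k in sequentially. ereal (root k (N (E k))) \<le> ereal (root k (K * M) * \<gamma>)"
    \<comment> \<open>\<open>root 0\<close> is constantly 0, so the root laws are applied for k >
      0.\<close>
    using bound eventually_gt_at_top[of 0]
  proof eventually_elim
    case (elim k)
    have "N (E k) \<le> K * M * \<gamma> ^ k"
      using K(2)[of "E k"] mult_left_mono[OF elim(1) less_imp_le[OF K(1)]] by (simp add: mult.assoc)
    then have "root k (N (E k)) \<le> root k (K * M * \<gamma> ^ k)" using elim by simp
    also have "\<dots> = root k (K * M) * \<gamma>"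
      using elim \<open>0 < \<gamma>\<close> by (simp add: real_root_mult real_root_power_cancel)
    finally show ?case by simp
  qed
  then have "limsup (\<lambda>k. ereal (root k (N (E k)))) \<le> limsup (\<lambda>k. ereal (root k (K * M) * \<gamma>))"
    by (rule Limsup_mono)
  also have "\<dots> = ereal \<gamma>"
  proof (rule lim_imp_Limsup)
    have "(\<lambda>k. root k (K * M) * \<gamma>) \<longlonglongrightarrow> 1 * \<gamma>"
      using K \<open>0 < M\<close> by (intro tendsto_intros LIMSEQ_root_const) auto
    then show "(\<lambda>k. ereal (root k (K * M) * \<gamma>)) \<longlonglongrightarrow> ereal \<gamma>" by simp
  qed simp
  finally show ?thesis .
qed

section \<open>Eigenvalues of an operator with values in a subspace\<close>

lemma op_eigenvalue_cong:
  "(\<And>x. x \<in> S \<Longrightarrow> T x = T' x) \<Longrightarrow> op_eigenvalue S T \<mu> \<longleftrightarrow> op_eigenvalue S T' \<mu>"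
  by (auto simp: op_eigenvalue_def)

text \<open>For \<mu> nonzero an eigenvector is a multiple of its own image. Multiplying T (U + i V)
  by the conjugate of \<mu> shows that U and V are real combinations of T U and T V, which lie in
  S.\<close>

lemma op_eigenvalue_subspace:
  assumes S: "subspace S" and range: "range T \<subseteq> S" and "\<mu> \<noteq> 0" and "op_eigenvalue UNIV T \<mu>"
  shows "op_eigenvalue S T \<mu>"
proof -
  obtain U V where UV: "U \<noteq> 0 \<or> V \<noteq> 0"
    "T U = Re \<mu> *\<^sub>R U - Im \<mu> *\<^sub>R V" "T V = Im \<mu> *\<^sub>R U + Re \<mu> *\<^sub>R V"
    using assms(4) by (auto simp: op_eigenvalue_def)
  define d where "d = (Re \<mu>)\<^sup>2 + (Im \<mu>)\<^sup>2"
  have d: "d \<noteq> 0" using \<open>\<mu> \<noteq> 0\<close> by (simp add: d_def complex_eq_iff)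
  have "Re \<mu> *\<^sub>R T U + Im \<mu> *\<^sub>R T V = d *\<^sub>R U" "Re \<mu> *\<^sub>R T V - Im \<mu> *\<^sub>R T U = d *\<^sub>R V"
    by (simp_all add: UV d_def algebra_simps power2_eq_square)
  moreover have "Re \<mu> *\<^sub>R T U + Im \<mu> *\<^sub>R T V \<in> S" "Re \<mu> *\<^sub>R T V - Im \<mu> *\<^sub>R T U \<in> S"
    using range S by (auto intro!: subspace_add subspace_diff subspace_scale)
  ultimately have "(1 / d) *\<^sub>R (d *\<^sub>R U) \<in> S" "(1 / d) *\<^sub>R (d *\<^sub>R V) \<in> S"
    using subspace_scale[OF S] by metis+
  then have "U \<in> S" "V \<in> S" using d by auto
  then show ?thesis using UV by (auto simp: op_eigenvalue_def)
qed

lemma cmod_le_op_spectral_radius: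
  fixes T :: "'a::euclidean_space \<Rightarrow> 'a"
  assumes "linear T" and "op_eigenvalue S T \<mu>"
  shows "cmod \<mu> \<le> op_spectral_radius S T"
proof -
  obtain K where K: "\<And>x. norm (T x) \<le> K * norm x" using linear_bounded[OF assms(1)] by blast
  have "cmod \<nu> \<le> K" if "op_eigenvalue S T \<nu>" for \<nu>
    using that by (intro op_eigenvalue_cmod_le[OF K]) (auto simp: op_eigenvalue_def)
  then have "bdd_above {cmod \<nu> | \<nu>. op_eigenvalue S T \<nu>}" by (auto simp: bdd_above_def)
  then show ?thesis unfolding op_spectral_radius_def using assms(2) by (intro cSup_upper) auto
qed

section \<open>Completing the square in the Riccati equation\<close>

lemma matrix_add_rdistrib: "(A + B) ** C = A ** C + (B :: 'a::semiring_1^'n^'m) ** C"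
  by (simp add: matrix_matrix_mult_def vec_eq_iff distrib_right sum.distrib)

lemma matrix_diff_ldistrib: "A ** (B - C) = A ** B - A ** (C :: 'a::ring_1^'n^'m)"
  by (simp add: matrix_matrix_mult_def vec_eq_iff right_diff_distrib sum_subtractf)

lemma matrix_diff_rdistrib: "(A - B) ** C = A ** C - (B :: 'a::ring_1^'n^'m) ** C"
  by (simp add: matrix_matrix_mult_def vec_eq_iff left_diff_distrib sum_subtractf)

lemma matrix_uminus_left: "(- A) ** B = - ((A :: 'a::ring_1^'n^'m) ** B)"
  by (simp add: matrix_matrix_mult_def vec_eq_iff sum_negf)

lemma matrix_uminus_right: "A ** (- B) = - ((A :: 'a::ring_1^'n^'m) ** B)"
  by (simp add: matrix_matrix_mult_def vec_eq_iff sum_negf)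

lemma matrix_sum_ldistrib: "A ** sum f I = (\<Sum>i\<in>I. (A :: 'a::ring_1^'n^'m) ** f i)"
  by (induction I rule: infinite_finite_induct) (simp_all add: matrix_add_ldistrib)

lemma matrix_sum_rdistrib: "sum f I ** A = (\<Sum>i\<in>I. f i ** (A :: 'a::ring_1^'n^'m))"
  by (induction I rule: infinite_finite_induct) (simp_all add: matrix_add_rdistrib)

lemma transpose_add: "transpose (A + B) = transpose A + transpose B"
  by (simp add: transpose_def vec_eq_iff)

lemma transpose_diff: "transpose (A - B) = transpose A - transpose B"
  by (simp add: transpose_def vec_eq_iff)

lemma transpose_sum: "transpose (sum f I) = (\<Sum>i\<in>I. transpose (f i))"
  by (simp add: transpose_def vec_eq_iff)

lemmas matrix_ring_simps =
  matrix_add_ldistrib matrix_add_rdistrib matrix_diff_ldistrib matrix_diff_rdistrib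
  matrix_uminus_left matrix_uminus_right matrix_sum_ldistrib matrix_sum_rdistrib
  matrix_mul_assoc

lemmas transpose_simps = transpose_add transpose_diff transpose_sum matrix_transpose_mul

lemma linear_matrix_mult_left: "linear (\<lambda>Z. A ** Z :: 'a::real_algebra_1^'p^'m)"
  by (rule linearI) (simp_all add: matrix_add_ldistrib matrix_scalar_ac scalar_matrix_assoc)

lemma linear_matrix_mult_right: "linear (\<lambda>Z. Z ** A :: 'a::real_algebra_1^'p^'m)"
  by (rule linearI) (simp_all add: matrix_add_rdistrib scalar_matrix_assoc)

lemma bounded_bilinear_matrix_mult:
  "bounded_bilinear ((**) :: real^'n^'m \<Rightarrow> real^'p^'n \<Rightarrow> real^'p^'m)"
  unfolding bilinear_conv_bounded_bilinear[symmetric] bilinear_def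
  by (auto intro: linear_matrix_mult_left linear_matrix_mult_right)

lemma linear_transpose: "linear (transpose :: real^'n^'m \<Rightarrow> real^'m^'n)"
  by (rule linearI) (simp_all add: transpose_add transpose_scalar)

lemma cmat_mult: "cmat (A ** B) = cmat A ** cmat B"
  by (simp add: matrix_matrix_mult_def vec_eq_iff)

lemma cmat_add: "cmat (A + B) = cmat A + cmat B"
  by (simp add: vec_eq_iff)

lemma cmat_diff: "cmat (A - B) = cmat A - cmat B"
  by (simp add: vec_eq_iff)

lemma cmat_sum: "cmat (sum f I) = (\<Sum>i\<in>I. cmat (f i))"
  by (simp add: vec_eq_iff)

lemma cmat_transpose: "cmat (transpose A) = transpose (cmat A)"
  by (simp add: transpose_def vec_eq_iff)

lemmas cmat_simps = cmat_mult cmat_add cmat_diff cmat_sum cmat_transpose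

lemma norm_cmat: "norm (cmat A) = norm A"
  by (simp add: norm_vec_def)

lemma hcat_mult_vcat:
  fixes X :: "'a::ring_1^'c^'r"
  shows "hcat X Y ** vcat Z W = X ** Z + Y ** W"
  unfolding vec_eq_iff matrix_matrix_mult_def hcat_def vcat_def
  by (simp add: UNIV_Plus_UNIV[symmetric] sum.Plus del: UNIV_Plus_UNIV)

lemma mult_hcat: "Z ** hcat X Y = hcat (Z ** X) (Z ** Y)"
  by (auto simp: vec_eq_iff matrix_matrix_mult_def hcat_def split: sum.split)

lemma hcat_add: "hcat X Y + hcat Z W = hcat (X + Z) (Y + W)"
  by (auto simp: vec_eq_iff hcat_def split: sum.split)

lemma block_quadratic_form:
  fixes Y :: "'a::comm_ring_1^'m^'n"
  shows "hcat (mat 1) Y ** Pi_op r A0 B0 Z ** vcat (mat 1) W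
    = Pi11 r A0 Z + Y ** Pi21 r A0 B0 Z + (Pi12 r A0 B0 Z + Y ** Pi22 r B0 Z) ** W"
  by (simp add: Pi_op_def hcat_mult_vcat mult_hcat hcat_add)

text \<open>For the limit feedback K the right-hand side is \<Psi> multiplied out; the left-hand
  side is the form that visibly preserves Hermitian matrices.\<close>

lemma Pi11_feedback:
  "Pi11 r (\<lambda>i. A0 i - B0 i ** K) Z
    = Pi11 r A0 Z - Pi12 r A0 B0 Z ** K - transpose K ** Pi21 r A0 B0 Z
      + transpose K ** Pi22 r B0 Z ** K"
  by (simp add: Pi11_def Pi12_def Pi21_def Pi22_def matrix_ring_simps transpose_simps
      sum.distrib sum_subtractf algebra_simps)

lemma cmat_Pi11: "cmat (Pi11 r A0 Z) = Pi11 r (\<lambda>i. cmat (A0 i)) (cmat Z)"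
  by (simp add: Pi11_def cmat_simps)

lemma Pi11_diff: "Pi11 r A0 (Y - Z) = Pi11 r A0 Y - Pi11 r A0 Z"
  by (simp add: Pi11_def matrix_ring_simps sum_subtractf)

lemma Pi12_diff: "Pi12 r A0 B0 (Y - Z) = Pi12 r A0 B0 Y - Pi12 r A0 B0 Z"
  by (simp add: Pi12_def matrix_ring_simps sum_subtractf)

lemma Pi21_diff: "Pi21 r A0 B0 (Y - Z) = Pi21 r A0 B0 Y - Pi21 r A0 B0 Z"
  by (simp add: Pi21_def matrix_ring_simps sum_subtractf)

lemma Pi22_diff: "Pi22 r B0 (Y - Z) = Pi22 r B0 Y - Pi22 r B0 Z"
  by (simp add: Pi22_def matrix_ring_simps sum_subtractf)

lemma transpose_Pi12: "transpose Z = Z \<Longrightarrow> transpose (Pi12 r A0 B0 Z) = Pi21 r A0 B0 Z"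
  by (simp add: Pi12_def Pi21_def transpose_simps matrix_ring_simps)

lemma transpose_Pi22: "transpose Z = Z \<Longrightarrow> transpose (Pi22 r B0 Z) = Pi22 r B0 Z"
  by (simp add: Pi22_def transpose_simps matrix_ring_simps)

lemma linear_Pi11: "linear (Pi11 r A0 :: 'a::{real_algebra_1,comm_ring_1}^'n^'n \<Rightarrow> _)"
  unfolding Pi11_def
  by (intro linear_compose_sum ballI linear_compose[OF linear_matrix_mult_left linear_matrix_mult_right, unfolded comp_def])

lemma linear_Pi12: "linear (Pi12 r A0 B0 :: 'a::{real_algebra_1,comm_ring_1}^'n^'n \<Rightarrow> _)"
  unfolding Pi12_def
  by (intro linear_compose_sum ballI linear_compose[OF linear_matrix_mult_left linear_matrix_mult_right, unfolded comp_def])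

lemma linear_Pi22: "linear (Pi22 r B0 :: 'a::{real_algebra_1,comm_ring_1}^'n^'n \<Rightarrow> _)"
  unfolding Pi22_def
  by (intro linear_compose_sum ballI linear_compose[OF linear_matrix_mult_left linear_matrix_mult_right, unfolded comp_def])

text \<open>Polymorphic, so that the real error recurrence and, through \<open>cmat\<close>, the
  complex operator \<L> share it.\<close>

definition lyapunov :: "'a::comm_ring_1^'n^'n \<Rightarrow> 'a^'n^'n \<Rightarrow> 'a^'n^'n" where
  "lyapunov M Z = transpose M ** Z + Z ** M"

lemma cmat_lyapunov: "cmat (lyapunov M Z) = lyapunov (cmat M) (cmat Z)"
  by (simp add: lyapunov_def cmat_simps)

lemma linear_lyapunov: "linear (lyapunov M :: 'a::{real_algebra_1,comm_ring_1}^'n^'n \<Rightarrow> _)"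
  unfolding lyapunov_def
  by (intro linear_compose_add linear_matrix_mult_left linear_matrix_mult_right)

section \<open>Hermitian matrices as a real subspace\<close>

lemma hermitian_zero: "hermitian 0"
  by (simp add: hermitian_def transpose_def vec_eq_iff)

lemma hermitian_add: "hermitian Y \<Longrightarrow> hermitian Z \<Longrightarrow> hermitian (Y + Z)"
  by (simp add: hermitian_def transpose_def vec_eq_iff)

lemma subspace_hermitian: "subspace (Collect hermitian)"
  by (auto simp: subspace_def hermitian_zero hermitian_add)
     (simp add: hermitian_def transpose_def vec_eq_iff)

lemma hermitian_cmat: "transpose E = E \<Longrightarrow> hermitian (cmat E)"
  by (simp add: hermitian_def transpose_def vec_eq_iff)

lemma hermitian_conjugation:
  assumes "hermitian Z"
  shows "hermitian (transpose (cmat M) ** Z ** cmat M)"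
proof -
  have cnj_mult: "map_matrix cnj (Y ** W) = map_matrix cnj Y ** map_matrix cnj W"
    for Y :: "complex^'a^'b" and W :: "complex^'c^'a"
    by (simp add: matrix_matrix_mult_def vec_eq_iff)
  have "map_matrix cnj (cmat M) = cmat M" "map_matrix cnj (transpose (cmat M)) = transpose (cmat M)"
    by (simp_all add: vec_eq_iff transpose_def)
  then show ?thesis using assms
    by (simp add: hermitian_def cnj_mult matrix_transpose_mul matrix_mul_assoc)
qed

lemma hermitian_Pi11: "hermitian Z \<Longrightarrow> hermitian (Pi11 r (\<lambda>i. cmat (M i)) Z)"
  unfolding Pi11_def by (intro subspace_sum[OF subspace_hermitian, simplified] hermitian_conjugation)

section \<open>The square and its uniformly bounded inverse\<close>

lemma matrix_inv_mult_cancel: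
  fixes R :: "real^'m^'m"
  assumes "invertible R"
  shows "Z ** matrix_inv R ** R = Z" "Z ** R ** matrix_inv R = Z"
proof -
  have "R ** matrix_inv R = mat 1 \<and> matrix_inv R ** R = mat 1"
    using someI_ex[OF assms[unfolded invertible_def]] by (simp add: matrix_inv_def)
  then show "Z ** matrix_inv R ** R = Z" "Z ** R ** matrix_inv R = Z"
    by (simp_all add: matrix_mul_assoc[symmetric])
qed

lemma transpose_matrix_inv:
  fixes R :: "real^'m^'m"
  assumes "invertible R" "transpose R = R"
  shows "transpose (matrix_inv R) = matrix_inv R"
proof -
  have "transpose (mat 1 ** matrix_inv R ** R) = mat 1"
    using matrix_inv_mult_cancel(1)[OF assms(1), of "mat 1"] by simp
  then have "R ** transpose (matrix_inv R) = mat 1"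
    by (simp add: matrix_transpose_mul assms(2))
  then have "matrix_inv R ** R ** transpose (matrix_inv R) = matrix_inv R"
    by (simp add: matrix_mul_assoc[symmetric])
  then show ?thesis using matrix_inv_mult_cancel(1)[OF assms(1), of "mat 1"] by simp
qed

text \<open>Expand the last product and cancel R against its inverse. K is free: once it is fixed,
  all terms but the last are affine in (S, R).\<close>

lemma completing_square:
  fixes S :: "real^'m^'n" and R :: "real^'m^'m" and K :: "real^'n^'m"
  assumes "invertible R" "transpose R = R"
  shows "S ** matrix_inv R ** transpose S = S ** K + transpose K ** transpose S - transpose K ** R ** K
    + (S - transpose K ** R) ** matrix_inv R ** transpose (S - transpose K ** R)"
  by (simp add: matrix_ring_simps transpose_simps assms matrix_inv_mult_cancel)

text \<open>The coefficients A_c, G_c, H_c arise by expanding (L + W B) Ri (L + W B)'. Undoing this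
  gathers everything nonlinear into one term.\<close>

lemma riccati_eq_schur:
  assumes "transpose W = W" "transpose Ri = Ri"
  shows "transpose (A - B ** Ri ** transpose L) ** W + W ** (A - B ** Ri ** transpose L)
      - W ** (B ** Ri ** transpose B) ** W + (Q - L ** Ri ** transpose L)
    = Q + transpose A ** W + W ** A - (L + W ** B) ** Ri ** transpose (L + W ** (B :: real^'m^'n))"
  by (simp add: matrix_ring_simps transpose_simps assms)

lemma pd_coercive:
  fixes R :: "real^'m^'m"
  assumes "pd R"
  obtains c where "0 < c" "\<And>x. c * (norm x)\<^sup>2 \<le> x \<bullet> (R *v x)"
proof -
  let ?f = "\<lambda>x. x \<bullet> (R *v x)"
  have "continuous_on (sphere 0 1) ?f"
    by (intro continuous_intros matrix_vector_mult_linear_continuous_on)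
  moreover have "sphere 0 (1::real) \<noteq> ({} :: (real^'m) set)" by simp
  ultimately obtain z where z: "z \<in> sphere 0 1" "\<And>y. y \<in> sphere 0 1 \<Longrightarrow> ?f z \<le> ?f y"
    using continuous_attains_inf[OF compact_sphere] by blast
  have "z \<noteq> 0" using z(1) by auto
  then have "0 < ?f z" using assms by (simp add: pd_def)
  moreover have "?f z * (norm x)\<^sup>2 \<le> ?f x" for x
  proof (cases "x = 0")
    case False
    define y where "y = (1 / norm x) *\<^sub>R x"
    have x: "x = norm x *\<^sub>R y" using False by (simp add: y_def)
    have "?f x = (norm x)\<^sup>2 * ?f y"
      by (subst (1 2) x) (simp add: matrix_vector_mult_scaleR power2_eq_square)
    moreover have "?f z \<le> ?f y" using False by (intro z) (simp add: y_def)
    ultimately show ?thesis by (simp add: mult.commute mult_right_mono)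
  qed simp
  ultimately show ?thesis by (rule that)
qed

text \<open>Cauchy-Schwarz turns coercivity into c |x| \<le> |R x|, so the columns of the inverse
  have norm at most 1/c. Summing over all entries is crude, but the bound depends on c and the
  dimension alone.\<close>

lemma coercive_inverse:
  fixes R :: "real^'m^'m"
  assumes "0 < c" and coer: "\<And>x. c * (norm x)\<^sup>2 \<le> x \<bullet> (R *v x)"
  shows "invertible R" "norm (matrix_inv R) \<le> real CARD('m) * real CARD('m) / c"
proof -
  have lower: "c * norm x \<le> norm (R *v x)" for x
  proof (cases "x = 0")
    case False
    have "(c * norm x) * norm x \<le> norm (R *v x) * norm x"
      using coer[of x] norm_cauchy_schwarz[of x "R *v x"] by (simp add: power2_eq_square mult.assoc mult.commute[of "norm (R *v x)"])
    then show ?thesis using False mult_le_cancel_right_pos[of "norm x"] by simp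
  qed simp
  then have "x = 0" if "R *v x = 0" for x
    using lower[of x] that \<open>0 < c\<close> by (simp add: mult_le_0_iff)
  then show inv: "invertible R"
    by (simp add: invertible_left_inverse matrix_left_invertible_ker)
  have entry: "\<bar>matrix_inv R $ i $ j\<bar> \<le> 1 / c" for i j
  proof -
    let ?v = "matrix_inv R *v axis j 1"
    have "R *v ?v = axis j 1"
      using matrix_inv_mult_cancel(2)[OF inv, of "mat 1"] by (simp add: matrix_vector_mul_assoc)
    then have "norm ?v \<le> 1 / c" using lower[of ?v] \<open>0 < c\<close> by (simp add: field_simps)
    moreover have "matrix_inv R $ i $ j = ?v $ i"
      by (simp add: matrix_vector_mult_def axis_def if_distrib cong: if_cong)
    ultimately show ?thesis using component_le_norm_cart[of ?v i] by linarith
  qed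
  have "norm (matrix_inv R) \<le> (\<Sum>i\<in>UNIV. norm (matrix_inv R $ i))"
    unfolding norm_vec_def[of "matrix_inv R"] by (rule L2_set_le_sum) simp
  also have "\<dots> \<le> (\<Sum>i::'m\<in>UNIV. \<Sum>j::'m\<in>UNIV. 1 / c)"
    by (intro sum_mono order_trans[OF norm_le_l1_cart] entry)
  finally show "norm (matrix_inv R) \<le> real CARD('m) * real CARD('m) / c" by simp
qed

lemma psd_Pi22:
  assumes "psd Z"
  shows "psd (Pi22 r B0 Z)"
proof -
  have "x \<bullet> (Pi22 r B0 Z *v x) = (\<Sum>i=1..r. (B0 i *v x) \<bullet> (Z *v (B0 i *v x)))" for x
  proof -
    have "Pi22 r B0 Z *v x = (\<Sum>i=1..r. transpose (B0 i) *v (Z *v (B0 i *v x)))"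
      unfolding Pi22_def
      by (induction r) (simp_all add: matrix_vector_mult_add_rdistrib matrix_vector_mul_assoc matrix_mul_assoc del: transpose_matrix_vector)
    moreover have "x \<bullet> (y v* B0 i) = (B0 i *v x) \<bullet> y" for y i
      by (metis dot_lmul_matrix inner_commute)
    ultimately show ?thesis by (simp add: inner_sum_right)
  qed
  then show ?thesis using assms by (auto simp: psd_def transpose_Pi22 intro!: sum_nonneg)
qed

text \<open>Adding the positive semidefinite \<open>Pi22 r B0 Z\<close> preserves the coercivity
  constant of R, so one \<beta> serves all Z and hence the whole iteration.\<close>

lemma Rc_properties:
  fixes R :: "real^'m^'m"
  assumes "pd R"
  obtains \<beta> where "\<And>Z. psd Z \<Longrightarrow> transpose (Rc r B0 R Z) = Rc r B0 R Z"
    "\<And>Z. psd Z \<Longrightarrow> invertible (Rc r B0 R Z)"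
    "\<And>Z. psd Z \<Longrightarrow> norm (matrix_inv (Rc r B0 R Z)) \<le> \<beta>"
proof -
  obtain c where c: "0 < c" "\<And>x. c * (norm x)\<^sup>2 \<le> x \<bullet> (R *v x)" using pd_coercive[OF assms] by blast
  have coer: "c * (norm x)\<^sup>2 \<le> x \<bullet> (Rc r B0 R Z *v x)" if "psd Z" for x Z
    using c(2)[of x] psd_Pi22[OF that, of r B0]
    by (simp add: Rc_def psd_def matrix_vector_mult_add_rdistrib inner_add_right add_increasing2)
  show ?thesis
  proof (rule that)
    show "transpose (Rc r B0 R Z) = Rc r B0 R Z" if "psd Z" for Z
      using assms psd_Pi22[OF that, of r B0] by (simp add: Rc_def pd_def psd_def transpose_add)
  qed (use coercive_inverse[OF c(1) coer] in blast)+
qed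

section \<open>The limit operators in feedback form and the residual\<close>

lemma Lyap_op_eq:
  assumes "transpose Xh = Xh" "transpose Ri = Ri" and Ri: "Ri = matrix_inv (Rc r B0 R Xh)"
    and K_def: "K = Ri ** transpose (Lc r A0 B0 L Xh + Xh ** B)"
  shows "Lyap_op r A0 B0 A B L R Xh = lyapunov (cmat (A - B ** K))"
proof -
  \<comment> \<open>K merges the feedback Ri L' inside Ac with the gain Ri B' Xh from Gc Xh.\<close>
  have "Ac r A0 B0 A B L R Xh - Gc r B0 B R Xh ** Xh = A - B ** K"
    by (simp add: Ac_def Gc_def K_def Ri[symmetric] matrix_ring_simps transpose_simps assms(1))
  moreover from arg_cong[OF this, of transpose]
  have "transpose (Ac r A0 B0 A B L R Xh) - Xh ** Gc r B0 B R Xh = transpose (A - B ** K)"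
    by (simp add: Gc_def Ri[symmetric] transpose_simps assms(1,2) matrix_mul_assoc)
  ultimately show ?thesis
    by (intro ext) (simp add: Lyap_op_def Let_def lyapunov_def cmat_transpose)
qed

text \<open>Split K into Ri L' and Ri B' Xh. The terms with the first part alone form the block
  product in \<open>Psi_op\<close>; those involving the second are its summands with Xh.\<close>

lemma Psi_op_eq:
  fixes Xh :: "real^'n^'n"
  assumes "transpose Xh = Xh" "transpose Ri = Ri" and Ri: "Ri = matrix_inv (Rc r B0 R Xh)"
    and K_def: "K = Ri ** transpose (Lc r A0 B0 L Xh + Xh ** B)"
  shows "Psi_op r A0 B0 B L R Xh = Pi11 r (\<lambda>i. cmat (A0 i - B0 i ** K))"
proof
  fix Z :: "complex^'n^'n"
  have K: "cmat K = cmat Ri ** transpose (cmat (Lc r A0 B0 L Xh))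
      + cmat Ri ** transpose (cmat B) ** cmat Xh"
    by (simp add: K_def cmat_simps transpose_simps matrix_ring_simps assms(1) flip: cmat_transpose[of Xh])
  have Kt: "transpose (cmat K) = cmat (Lc r A0 B0 L Xh) ** cmat Ri + cmat Xh ** cmat B ** cmat Ri"
    by (simp add: K_def cmat_simps transpose_simps matrix_ring_simps assms(1,2) flip: cmat_transpose)
  show "Psi_op r A0 B0 B L R Xh Z = Pi11 r (\<lambda>i. cmat (A0 i - B0 i ** K)) Z"
    unfolding Psi_op_def Let_def cmat_diff cmat_mult Pi11_feedback block_quadratic_form Kt Ri[symmetric]
    unfolding K by (simp add: matrix_ring_simps cmat_transpose)
qed

text \<open>D is the factor S - K' R(Y) of the completed square. It is affine in (Y, W) and zero at
  (Xh, Xh), so only differences occur in it.\<close>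

lemma riccati_residual:
  fixes Y W Xh :: "real^'n^'n" and B L :: "real^'m^'n"
  assumes ric: "psd_stabilizing_solution (Ac r A0 B0 A B L R Y) (Gc r B0 B R Y) (Hc r A0 B0 Q L R Y) W"
    and Y: "transpose Y = Y" and RY: "invertible (Rc r B0 R Y)" "transpose (Rc r B0 R Y) = Rc r B0 R Y"
    and Xh: "transpose Xh = Xh" and RX: "invertible (Rc r B0 R Xh)" "transpose (Rc r B0 R Xh) = Rc r B0 R Xh"
    and K: "K = matrix_inv (Rc r B0 R Xh) ** transpose (Lc r A0 B0 L Xh + Xh ** B)"
    and D: "D = Pi12 r A0 B0 (Y - Xh) + (W - Xh) ** B - transpose K ** Pi22 r B0 (Y - Xh)"
  shows "Pi11 r (\<lambda>i. A0 i - B0 i ** K) Xh + lyapunov (A - B ** K) Xh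
      + Q + transpose K ** R ** K - L ** K - transpose K ** transpose L
      + lyapunov (A - B ** K) (W - Xh) + Pi11 r (\<lambda>i. A0 i - B0 i ** K) (Y - Xh)
    = D ** matrix_inv (Rc r B0 R Y) ** transpose D"
proof -
  define S where "S = Lc r A0 B0 L Y + W ** B"
  define RY where "RY = Rc r B0 R Y"
  have W: "transpose W = W" using ric by (simp add: psd_stabilizing_solution_def psd_def)
  have inv: "invertible RY" "transpose RY = RY" using RY by (simp_all add: RY_def)
  have eq: "Qc r A0 Q Y + transpose A ** W + W ** A - S ** matrix_inv RY ** transpose S = 0"
    using ric riccati_eq_schur[OF W transpose_matrix_inv[OF inv], of A B "Lc r A0 B0 L Y" "Qc r A0 Q Y"]
    by (simp add: psd_stabilizing_solution_def Ac_def Gc_def Hc_def S_def RY_def)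
  have "transpose K = (Lc r A0 B0 L Xh + Xh ** B) ** matrix_inv (Rc r B0 R Xh)"
    by (simp add: K matrix_transpose_mul transpose_matrix_inv[OF RX])
  \<comment> \<open>K was chosen for this: the factor vanishes at the limit, and subtracting this
    zero turns S - K' R(Y) into differences.\<close>
  then have crit: "Lc r A0 B0 L Xh + Xh ** B - transpose K ** Rc r B0 R Xh = 0"
    by (simp add: matrix_inv_mult_cancel[OF RX(1)])
  have "S - transpose K ** RY = (S - transpose K ** RY) - (Lc r A0 B0 L Xh + Xh ** B - transpose K ** Rc r B0 R Xh)"
    by (simp add: crit)
  also have "\<dots> = D"
    by (simp add: D S_def RY_def Lc_def Rc_def Pi12_diff Pi22_diff matrix_ring_simps)
  finally have SD: "S - transpose K ** RY = D" .
  have "D ** matrix_inv RY ** transpose D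
      = Qc r A0 Q Y + transpose A ** W + W ** A - (S ** K + transpose K ** transpose S - transpose K ** RY ** K)"
    using eq completing_square[OF inv, of S K] by (simp add: SD algebra_simps)
  also have "\<dots> = Q + Pi11 r A0 Y + transpose A ** W + W ** A - (L + Pi12 r A0 B0 Y + W ** B) ** K
      - transpose K ** (transpose L + Pi21 r A0 B0 Y + transpose B ** W)
      + transpose K ** (R + Pi22 r B0 Y) ** K"
    by (simp add: S_def RY_def Lc_def Rc_def Qc_def transpose_simps transpose_Pi12[OF Y] W)
  finally show ?thesis
    by (simp add: RY_def Pi11_feedback lyapunov_def Pi11_diff Pi12_diff Pi21_diff Pi22_diff
        matrix_ring_simps transpose_simps algebra_simps)
qed

text \<open>P stays an explicit factor because the inverse varies along the iteration while c must
  not.\<close>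

lemma quadratic_product_bound:
  fixes F :: "'a::euclidean_space \<Rightarrow> real^'m^'n"
  assumes "linear F"
  obtains c where "0 \<le> c"
    "\<And>x P. norm (F x ** P ** transpose (F x)) \<le> c * norm P * (norm x)\<^sup>2"
proof -
  obtain a where a: "0 < a" "\<And>x. norm (F x) \<le> a * norm x"
    using linear_bounded_pos[OF assms] by blast
  obtain t where t: "0 < t" "\<And>M :: real^'m^'n. norm (transpose M) \<le> t * norm M"
    using linear_bounded_pos[OF linear_transpose] by blast
  obtain k where k: "0 < k" "\<And>(M :: real^'m^'n) (P :: real^'m^'m). norm (M ** P) \<le> norm M * norm P * k"
    using bounded_bilinear.pos_bounded[OF bounded_bilinear_matrix_mult] by blast
  obtain l where l: "0 < l" "\<And>(M :: real^'m^'n) (P :: real^'n^'m). norm (M ** P) \<le> norm M * norm P * l"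
    using bounded_bilinear.pos_bounded[OF bounded_bilinear_matrix_mult] by blast
  have "norm (F x ** P ** transpose (F x)) \<le> (a * a * t * k * l) * norm P * (norm x)\<^sup>2" for x P
  proof -
    have "norm (F x ** P ** transpose (F x)) \<le> (norm (F x) * norm P * k) * (t * norm (F x)) * l"
      using l(2)[of "F x ** P" "transpose (F x)"] k l t a
      by (meson order_trans mult_mono mult_right_mono mult_nonneg_nonneg norm_ge_zero less_imp_le)
    also have "\<dots> \<le> ((a * norm x) * norm P * k) * (t * (a * norm x)) * l"
      using a t k l by (intro mult_mono mult_nonneg_nonneg) auto
    finally show ?thesis by (simp add: power2_eq_square algebra_simps)
  qed
  then show ?thesis using a t k l by (intro that[of "a * a * t * k * l"]) auto
qed

theorem theorem3p5:
  fixes A Q :: "real^'n^'n" and B L :: "real^'m^'n" and R :: "real^'m^'m"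
    and r :: nat and A0 :: "nat \<Rightarrow> real^'n^'n" and B0 :: "nat \<Rightarrow> real^'m^'n"
    and p :: nat and C :: "nat \<Rightarrow> real^'n"
    and X :: "nat \<Rightarrow> real^'n^'n" and Xhat :: "real^'n^'n"
  assumes "transpose Q = Q"
    and "pd R"
    and "psd (Q - L ** matrix_inv R ** transpose L)"
    and "stabilizable A B"
    and "full_rank_decomposition p C (Q - L ** matrix_inv R ** transpose L)"
    and "detectable p C A"
    and "rows_ker p C \<subseteq> (\<Inter>i\<in>{1..r}. ker (A0 i)) \<inter> ker (transpose L)"
    and "psd (X 0)"
    and "\<And>k. psd_stabilizing_solution (Ac r A0 B0 A B L R (X k)) (Gc r B0 B R (X k))
                (Hc r A0 B0 Q L R (X k)) (X (Suc k))"
    and "(\<forall>j k. j \<le> k \<longrightarrow> loewner_le (X j) (X k)) \<or> (\<forall>j k. j \<le> k \<longrightarrow> loewner_le (X k) (X j))"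
    and "X \<longlonglongrightarrow> Xhat"
    and "psd Xhat"
    and "bij_betw (Lyap_op r A0 B0 A B L R Xhat) (Collect hermitian) (Collect hermitian)"
    and "op_spectral_radius (Collect hermitian)
           (inv_into (Collect hermitian) (Lyap_op r A0 B0 A B L R Xhat)
             \<circ> Psi_op r A0 B0 B L R Xhat) < 1"
  shows "\<exists>\<gamma>::real. 0 < \<gamma> \<and> \<gamma> < 1 \<and>
           (\<forall>N :: real^'n^'n \<Rightarrow> real. is_matrix_norm N \<longrightarrow>
              limsup (\<lambda>k. ereal (root k (N (X k - Xhat)))) \<le> ereal \<gamma>)"
proof -
  note ric = assms(9) and lim = assms(11) and bij = assms(13) and rad = assms(14)
  let ?H = "Collect hermitian :: (complex^'n^'n) set"
  let ?\<L> = "Lyap_op r A0 B0 A B L R Xhat" and ?\<Psi> = "Psi_op r A0 B0 B L R Xhat"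
  obtain \<beta> where Rsym: "\<And>Z. psd Z \<Longrightarrow> transpose (Rc r B0 R Z) = Rc r B0 R Z"
    and Rinv: "\<And>Z. psd Z \<Longrightarrow> invertible (Rc r B0 R Z)"
    and Rbound: "\<And>Z. psd Z \<Longrightarrow> norm (matrix_inv (Rc r B0 R Z)) \<le> \<beta>"
    using Rc_properties[OF assms(2)] by metis
  have psdX: "psd (X k)" for k
    using assms(8) ric by (cases k) (auto simp: psd_stabilizing_solution_def)
  have symX: "transpose (X k) = X k" and symXh: "transpose Xhat = Xhat" for k
    using psdX[of k] assms(12) by (simp_all add: psd_def)
  define K where "K = matrix_inv (Rc r B0 R Xhat) ** transpose (Lc r A0 B0 L Xhat + Xhat ** B)"
  define M where "M = A - B ** K"
  define M0 where "M0 = (\<lambda>i. A0 i - B0 i ** K)"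
  note invsym = transpose_matrix_inv[OF Rinv Rsym, OF assms(12) assms(12)]
  have \<L>: "?\<L> = lyapunov (cmat M)" unfolding M_def
    by (rule Lyap_op_eq[OF symXh invsym refl K_def])
  have \<Psi>: "?\<Psi> = Pi11 r (\<lambda>i. cmat (M0 i))" unfolding M0_def
    by (rule Psi_op_eq[OF symXh invsym refl K_def])

  define E where "E = (\<lambda>k. X k - Xhat)"
  have E0: "E \<longlonglongrightarrow> 0" using lim by (simp add: E_def LIM_zero)
  define F where "F = (\<lambda>(Y, W). Pi12 r A0 B0 Y + W ** B - transpose K ** Pi22 r B0 Y)"
  have "linear F"
  proof -
    have "linear (\<lambda>x. Pi12 r A0 B0 (fst x) + snd x ** B - transpose K ** Pi22 r B0 (fst x))"
      by (intro linear_compose_add linear_compose_sub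
          linear_compose[OF linear_fst linear_Pi12, unfolded comp_def]
          linear_compose[OF linear_snd linear_matrix_mult_right, unfolded comp_def]
          linear_compose[OF linear_compose[OF linear_fst linear_Pi22] linear_matrix_mult_left, unfolded comp_def])
    then show ?thesis by (simp add: F_def case_prod_beta')
  qed
  then obtain c where c: "0 \<le> c"
    "\<And>x P. norm (F x ** P ** transpose (F x)) \<le> c * norm P * (norm x)\<^sup>2"
    using quadratic_product_bound by blast
  define \<rho> where "\<rho> = (\<lambda>k. F (E k, E (Suc k)) ** matrix_inv (Rc r B0 R (X k)) ** transpose (F (E k, E (Suc k))))"
  have \<beta>0: "0 \<le> \<beta>" using Rbound[OF assms(12)] norm_ge_zero order_trans by blast
  have \<rho>_bound: "norm (\<rho> k) \<le> c * \<beta> * (norm (E k) + norm (E (Suc k)))\<^sup>2" for k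
  proof -
    have "norm (\<rho> k) \<le> c * norm (matrix_inv (Rc r B0 R (X k))) * (norm (E k, E (Suc k)))\<^sup>2"
      unfolding \<rho>_def by (rule c)
    also have "\<dots> \<le> c * \<beta> * (norm (E k) + norm (E (Suc k)))\<^sup>2"
      using c(1) \<beta>0 Rbound[OF psdX] norm_Pair_le by (intro mult_mono power_mono) auto
    finally show ?thesis .
  qed
  define \<kappa> where "\<kappa> = Pi11 r M0 Xhat + lyapunov M Xhat + Q + transpose K ** R ** K
    - L ** K - transpose K ** transpose L"
  have step: "\<kappa> + lyapunov M (E (Suc k)) + Pi11 r M0 (E k) = \<rho> k" for k
    using riccati_residual[OF ric symX Rinv[OF psdX] Rsym[OF psdX] symXh Rinv[OF assms(12)]
        Rsym[OF assms(12)] K_def refl]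
    by (simp add: \<kappa>_def \<rho>_def F_def E_def M_def M0_def)
  \<comment> \<open>All other terms of \<open>step\<close> tend to 0. The conclusion is the limit
    Riccati equation for \<open>Xhat\<close>, written with K.\<close>
  have "\<kappa> = 0"
  proof -
    have "(\<lambda>k. c * \<beta> * (norm (E k) + norm (E (Suc k)))\<^sup>2) \<longlonglongrightarrow> c * \<beta> * (0 + 0)\<^sup>2"
      using E0 LIMSEQ_Suc[OF E0] by (intro tendsto_intros tendsto_norm_zero) auto
    then have "(\<lambda>k. c * \<beta> * (norm (E k) + norm (E (Suc k)))\<^sup>2) \<longlonglongrightarrow> 0" by simp
    then have "\<rho> \<longlonglongrightarrow> 0"
      by (rule Lim_null_comparison[rotated]) (simp add: \<rho>_bound)
    moreover have "(\<lambda>k. lyapunov M (E (Suc k))) \<longlonglongrightarrow> 0" "(\<lambda>k. Pi11 r M0 (E k)) \<longlonglongrightarrow> 0"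
      using bounded_linear.tendsto_zero[OF linear_conv_bounded_linear[THEN iffD1, OF linear_lyapunov] LIMSEQ_Suc[OF E0]]
        bounded_linear.tendsto_zero[OF linear_conv_bounded_linear[THEN iffD1, OF linear_Pi11] E0] by auto
    ultimately have "(\<lambda>k. \<rho> k - lyapunov M (E (Suc k)) - Pi11 r M0 (E k)) \<longlonglongrightarrow> 0 - 0 - 0"
      by (intro tendsto_diff)
    moreover have "\<rho> k - lyapunov M (E (Suc k)) - Pi11 r M0 (E k) = \<kappa>" for k
      by (simp flip: step)
    ultimately show ?thesis by (simp add: LIMSEQ_const_iff)
  qed

  have lin\<L>: "linear ?\<L>" and lin\<Psi>: "linear ?\<Psi>"
    unfolding \<L> \<Psi> by (rule linear_lyapunov linear_Pi11)+
  \<comment> \<open>\<open>inv_into\<close> is unspecified off the Hermitian matrices; g agrees with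
    it there and is linear on the whole type, as the spectral lemmas require.\<close>
  obtain g where g: "range g \<subseteq> ?H" "linear g" "\<And>Z. Z \<in> ?H \<Longrightarrow> g (?\<L> Z) = Z"
    using linear_exists_left_inverse_on[OF lin\<L> subspace_hermitian bij_betw_imp_inj_on[OF bij]] by blast
  define T where "T = g \<circ> ?\<Psi>"
  have linT: "linear T" unfolding T_def by (rule linear_compose[OF lin\<Psi> g(2)])
  have rangeT: "range T \<subseteq> ?H" using g(1) by (auto simp: T_def)
  have T_eq: "(inv_into ?H ?\<L> \<circ> ?\<Psi>) Z = T Z" if "Z \<in> ?H" for Z
  proof -
    have "?\<Psi> Z \<in> ?\<L> ` ?H"
      using that bij_betw_imp_surj_on[OF bij] by (simp add: \<Psi> hermitian_Pi11)
    then obtain Y where "Y \<in> ?H" "?\<Psi> Z = ?\<L> Y" by blast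
    then show ?thesis using g(3) inv_into_f_f[OF bij_betw_imp_inj_on[OF bij]] by (simp add: T_def)
  qed
  \<comment> \<open>Midpoint between the spectral radius and 1; the max keeps q positive whatever
    the value of the supremum.\<close>
  define q where "q = (1 + max 0 (op_spectral_radius ?H T)) / 2"
  have eig_eq: "op_eigenvalue ?H (inv_into ?H ?\<L> \<circ> ?\<Psi>) = op_eigenvalue ?H T"
    by (intro ext op_eigenvalue_cong T_eq)
  have "op_spectral_radius ?H T < 1"
    using rad unfolding op_spectral_radius_def eig_eq .
  then have q: "0 < q" "q < 1" "op_spectral_radius ?H T < q" by (auto simp: q_def)
  \<comment> \<open>The value 0 is separate: T may have a kernel outside the Hermitian
    matrices.\<close>
  have eig: "cmod \<mu> < q" if "op_eigenvalue UNIV T \<mu>" for \<mu>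
  proof (cases "\<mu> = 0")
    case False
    then show ?thesis
      using cmod_le_op_spectral_radius[OF linT op_eigenvalue_subspace[OF subspace_hermitian rangeT False that]]
        q by linarith
  qed (use q in simp)
  obtain b where b: "0 < b" "\<And>Z. norm (g Z) \<le> b * norm Z" using linear_bounded_pos[OF g(2)] by blast
  \<comment> \<open>Apply g to the recurrence: on Hermitian errors it undoes \<L>, and
    \<open>cmat\<close> preserves norms.\<close>
  have step': "norm (cmat (E (Suc k)) + T (cmat (E k)))
      \<le> (b * (c * \<beta>)) * (norm (cmat (E k)) + norm (cmat (E (Suc k))))\<^sup>2" for k
  proof -
    have "hermitian (cmat (E (Suc k)))"
      by (rule hermitian_cmat) (simp add: E_def transpose_diff symX symXh)
    then have "cmat (E (Suc k)) + T (cmat (E k)) = g (?\<L> (cmat (E (Suc k))) + ?\<Psi> (cmat (E k)))"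
      using g(3) by (simp add: T_def linear_add[OF g(2)])
    also have "\<dots> = g (cmat (\<rho> k))"
      using step[of k] \<open>\<kappa> = 0\<close> by (simp add: \<L> \<Psi> flip: cmat_add cmat_lyapunov cmat_Pi11)
    finally show ?thesis
      using b(2)[of "cmat (\<rho> k)"] mult_left_mono[OF \<rho>_bound[of k] less_imp_le[OF b(1)]]
      by (simp add: norm_cmat mult.assoc)
  qed
  have cE0: "(\<lambda>k. cmat (E k)) \<longlonglongrightarrow> 0"
    using E0 by (simp add: tendsto_norm_zero_iff[symmetric, where f="\<lambda>k. cmat (E k)"] norm_cmat tendsto_norm_zero)
  have "0 \<le> b * (c * \<beta>)" using b c(1) \<beta>0 by simp
  then obtain \<gamma> m where "0 < \<gamma>" "\<gamma> < 1" "0 < m"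
    "\<forall>\<^sub>F k in sequentially. norm (cmat (E k)) \<le> m * \<gamma> ^ k"
    using perturbed_iteration_linear_convergence[where e = "\<lambda>k. cmat (E k)", OF linT q(1,2) eig cE0 _ step']
    by blast
  then show ?thesis
    using matrix_norm_limsup_root_le by (intro exI[of _ \<gamma>]) (auto simp: norm_cmat E_def)
qed

end
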